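(* The function $I_\theta : \mathbf{Q}_\theta \to \mathbf{Z}$ satisfies, for all $x \in \mathbf{Q}_\theta$: \begin{enumerate} \item $I_\theta(-x) = -I_\theta(x)$; \item $I_\theta(x+2) = I_\theta(x)$; \item if $x \neq 0$, then $I_\theta(x) + I_\theta(1/x) = \mathrm{sign}(x)$. \end{enumerate} Moreover, $I_\theta$ is the unique function $\mathbf{Q}_\theta \to \mathbf{Z}$ satisfying properties (1)--(3).
   Context: $\mathbf{H}$ is the upper half plane. $\mathbf{Q}_\theta$ is the set of rationals $a/c$ with $\gcd(a,c)=1$, $c\ge 1$, $a+c$ odd (it is closed under $x\mapsto -x$, $x \mapsto x+2$, and $x\mapsto 1/x$ for $x\ne 0$). The net $\mathcal{N}_\theta$: for each pair of rationals $a/c$, $b/d$ in lowest terms with $c,d\ge1$, $a,b,c,d$ odd and $ad-bc=\pm2$, take the hyperbolic geodesic joining them, oriented from $a/c$ to $b/d$ if $c<d$, from $b/d$ to $a/c$ if $d<c$, and, if $c=d$ (which happens only when both endpoints are integers), declared doubly oriented. For oriented geodesics $g,h$ in $\mathbf{H}$, define $\varphi_g(h)=0$ if $g\cap h=\emptyset$ or $g$ is doubly oriented; otherwise, at the intersection point let $v$ be the tangent direction of $h$ and $w$ that of $g$, and set $\varphi_g(h)=+1$ if $w$ points to the right of $v$ (i.e. $\det(v,w)<0$ in $\mathbf{R}^2\cong\mathbf{C}$) and $\varphi_g(h)=-1$ if it points to the left. For $x\in\mathbf{Q}_\theta$ let $h_x$ be the oriented geodesic from $i\infty$ to $x$, and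 $I_\theta(x)=\sum_{g\in\mathcal{N}_\theta}\varphi_g(h_x)$ (only finitely many terms are nonzero). $\mathrm{sign}$ is the usual sign function. *)

theory Defs
  imports "HOL-Analysis.Analysis"
begin

datatype ideal_point = Infinity | Real_Point real

text \<open>
  A geodesic is given by its endpoints on the ideal boundary. A doubly oriented geodesic lists
  its endpoints in an order without significance.
\<close>

datatype oriented_geodesic =
    Directed ideal_point ideal_point
  | Doubly_Oriented ideal_point ideal_point

text \<open>
  Unit speed parametrisation of the complete geodesic from the first endpoint (parameter tending to
  \<open>-\<infinity>\<close>) to the second one (parameter tending to \<open>+\<infinity>\<close>). It is meaningful for distinct endpoints
  only; see the lemmas below for its image and for the fact that it preserves hyperbolic distance.
\<close>

fun geodesic_between :: "ideal_point \<Rightarrow> ideal_point \<Rightarrow> real \<Rightarrow> complex" where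
  "geodesic_between (Real_Point p) (Real_Point q) t =
     Complex ((p + q) / 2 + (q - p) / 2 * tanh t) (\<bar>q - p\<bar> / 2 / cosh t)"
| "geodesic_between Infinity (Real_Point q) t = Complex q (exp (- t))"
| "geodesic_between (Real_Point p) Infinity t = Complex p (exp t)"
| "geodesic_between Infinity Infinity t = undefined"

fun geodesic_param :: "oriented_geodesic \<Rightarrow> real \<Rightarrow> complex" where
  "geodesic_param (Directed p q) = geodesic_between p q"
| "geodesic_param (Doubly_Oriented p q) = geodesic_between p q"

definition geodesic_set :: "oriented_geodesic \<Rightarrow> complex set" where
  "geodesic_set g = range (geodesic_param g)"

definition tangent_direction :: "oriented_geodesic \<Rightarrow> complex \<Rightarrow> complex" where
  "tangent_direction g z = vector_derivative (geodesic_param g) (at (THE t. geodesic_param g t = z))"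

lemma abs_tanh_less_one: "\<bar>tanh (t::real)\<bar> < 1"
  using tanh_real_bounds[of t] by auto

lemma tanh_square_plus: "tanh t ^ 2 + (1 / cosh t) ^ 2 = (1::real)"
proof -
  have "cosh t \<noteq> 0" by (simp add: cosh_real_nonzero)
  have "tanh t ^ 2 + (1 / cosh t) ^ 2 = (sinh t ^ 2 + 1) / cosh t ^ 2"
    by (simp add: tanh_def power_divide add_divide_distrib)
  also have "sinh t ^ 2 + 1 = cosh t ^ 2" by (simp add: cosh_square_eq)
  finally show ?thesis using \<open>cosh t \<noteq> 0\<close> by simp
qed

lemma geodesic_half_circle:
  assumes "p \<noteq> q"
  shows "geodesic_set (Directed (Real_Point p) (Real_Point q)) =
    {z. Im z > 0 \<and> cmod (z - of_real ((p + q) / 2)) = \<bar>q - p\<bar> / 2}" (is "_ = ?S")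
proof (intro set_eqI iffI)
  fix z assume "z \<in> geodesic_set (Directed (Real_Point p) (Real_Point q))"
  then obtain t where z: "z = Complex ((p + q) / 2 + (q - p) / 2 * tanh t) (\<bar>q - p\<bar> / 2 / cosh t)"
    by (auto simp: geodesic_set_def)
  have "(cmod (z - of_real ((p + q) / 2)))\<^sup>2 = ((q - p) / 2 * tanh t)\<^sup>2 + (\<bar>q - p\<bar> / 2 / cosh t)\<^sup>2"
    by (simp add: z cmod_power2)
  also have "\<dots> = ((q - p) / 2)\<^sup>2 * (tanh t ^ 2 + (1 / cosh t) ^ 2)"
    by (simp add: power_mult_distrib power_divide distrib_left)
  also have "\<dots> = (\<bar>q - p\<bar> / 2)\<^sup>2"
    by (simp only: tanh_square_plus) (simp add: power_divide)
  finally have "cmod (z - of_real ((p + q) / 2)) = \<bar>q - p\<bar> / 2"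
    by (rule power2_eq_imp_eq) auto
  moreover have "Im z > 0" using assms by (simp add: z cosh_real_pos)
  ultimately show "z \<in> ?S" by simp
next
  fix z assume z: "z \<in> ?S"
  define r where "r = \<bar>q - p\<bar> / 2"
  define u where "u = (Re z - (p + q) / 2) / ((q - p) / 2)"
  have r: "r > 0" using assms by (simp add: r_def)
  have r2: "r\<^sup>2 = ((q - p) / 2)\<^sup>2" by (simp add: r_def power_divide)
  have Rez: "Re z = (p + q) / 2 + (q - p) / 2 * u"
  proof -
    have "(q - p) / 2 * u = Re z - (p + q) / 2"
      unfolding u_def using assms by (simp only: times_divide_eq_right) (rule nonzero_mult_div_cancel_left, simp)
    then show ?thesis by linarith
  qed
  have "(cmod (z - of_real ((p + q) / 2)))\<^sup>2 = r\<^sup>2" using z by (simp add: r_def)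
  then have "((q - p) / 2 * u)\<^sup>2 + (Im z)\<^sup>2 = r\<^sup>2"
    by (simp add: cmod_power2 Rez)
  then have eq: "(Im z)\<^sup>2 = r\<^sup>2 * (1 - u\<^sup>2)"
    unfolding r2 power_mult_distrib right_diff_distrib mult_1_right by linarith
  have "(Im z)\<^sup>2 > 0" using z by simp
  with eq have "u\<^sup>2 < 1" using r by (simp add: zero_less_mult_iff)
  then have "\<bar>u\<bar> < 1" by (simp add: abs_square_less_1)
  then have u: "1 - u > 0" "1 + u > 0" by auto
  define t where "t = ln ((1 + u) / (1 - u)) / 2"
  have "exp (- 2 * t) = (1 - u) / (1 + u)" using u by (simp add: t_def exp_minus)
  then have "tanh t = (1 - (1 - u) / (1 + u)) / (1 + (1 - u) / (1 + u))"
    by (simp only: tanh_real_altdef)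
  also have "\<dots> = u" using u by (simp add: field_simps)
  finally have t: "tanh t = u" .
  have "(1 / cosh t)\<^sup>2 = 1 - u\<^sup>2" using tanh_square_plus[of t] t by simp
  then have "(Im z)\<^sup>2 = (r / cosh t)\<^sup>2"
    by (simp only: eq power_divide flip: \<open>(1 / cosh t)\<^sup>2 = 1 - u\<^sup>2\<close>) simp
  then have "Im z = r / cosh t"
    by (rule power2_eq_imp_eq) (use z r in \<open>auto simp: cosh_real_pos less_imp_le\<close>)
  then have "z = geodesic_param (Directed (Real_Point p) (Real_Point q)) t"
    by (simp add: complex_eq_iff Rez t r_def)
  then show "z \<in> geodesic_set (Directed (Real_Point p) (Real_Point q))" by (auto simp: geodesic_set_def)
qed

lemma geodesic_half_line:
  "geodesic_set (Directed Infinity (Real_Point x)) = {z. Im z > 0 \<and> Re z = x}"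
proof (intro set_eqI iffI)
  fix z assume "z \<in> {z. Im z > 0 \<and> Re z = x}"
  then have "z = geodesic_param (Directed Infinity (Real_Point x)) (- ln (Im z))"
    by (simp add: complex_eq_iff)
  then show "z \<in> geodesic_set (Directed Infinity (Real_Point x))" unfolding geodesic_set_def by blast
qed (auto simp: geodesic_set_def)

text \<open>The left-hand side is the hyperbolic cosine of the hyperbolic distance.\<close>

lemma geodesic_between_isometric:
  assumes "p \<noteq> q"
  shows "1 + (cmod (geodesic_between p q s - geodesic_between p q t))\<^sup>2 /
    (2 * Im (geodesic_between p q s) * Im (geodesic_between p q t)) = cosh (s - t)"
proof -
  have exp_case: "1 + (exp a - exp b)\<^sup>2 / (2 * exp a * exp b) = cosh (a - b)" for a b :: real
    by (simp add: cosh_def field_simps power2_eq_square exp_diff exp_minus)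
  show ?thesis
  proof (cases p; cases q)
    fix a b assume pq: "p = Real_Point a" "q = Real_Point b"
    with assms have ab: "a \<noteq> b" by simp
    define r where "r = (b - a) / 2"
    have r: "r \<noteq> 0" using ab by (simp add: r_def)
    have abs_r: "\<bar>b - a\<bar> / 2 = \<bar>r\<bar>" by (simp add: r_def)
    have c: "cosh s > 0" "cosh t > 0" by (simp_all add: cosh_real_pos)
    have diff: "geodesic_between p q s - geodesic_between p q t =
        Complex (r * (tanh s - tanh t)) (\<bar>r\<bar> * (1 / cosh s - 1 / cosh t))"
      by (simp add: pq complex_eq_iff abs_r right_diff_distrib flip: r_def)
    have ims: "Im (geodesic_between p q s) = \<bar>r\<bar> / cosh s" "Im (geodesic_between p q t) = \<bar>r\<bar> / cosh t"
      by (simp_all add: pq abs_r)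
    have num: "(cmod (geodesic_between p q s - geodesic_between p q t))\<^sup>2 =
        r\<^sup>2 * ((tanh s - tanh t)\<^sup>2 + (1 / cosh s - 1 / cosh t)\<^sup>2)"
      by (simp add: diff cmod_power2 power_mult_distrib distrib_left)
    have "(tanh s - tanh t)\<^sup>2 + (1 / cosh s - 1 / cosh t)\<^sup>2 =
        (tanh s ^ 2 + (1 / cosh s) ^ 2) + (tanh t ^ 2 + (1 / cosh t) ^ 2)
          - 2 * (tanh s * tanh t + 1 / cosh s * (1 / cosh t))"
      by algebra
    also have "\<dots> = 2 - 2 * (tanh s * tanh t + 1 / cosh s * (1 / cosh t))"
      by (simp only: tanh_square_plus)
    also have "\<dots> = 2 * (cosh s * cosh t - sinh s * sinh t - 1) / (cosh s * cosh t)"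
      using c by (simp add: tanh_def field_simps)
    also have "cosh s * cosh t - sinh s * sinh t = cosh (s - t)" by (simp add: cosh_diff)
    finally have "(cmod (geodesic_between p q s - geodesic_between p q t))\<^sup>2 =
        r\<^sup>2 * (2 * (cosh (s - t) - 1) / (cosh s * cosh t))" by (simp add: num)
    moreover have "2 * Im (geodesic_between p q s) * Im (geodesic_between p q t) =
        2 * r\<^sup>2 / (cosh s * cosh t)"
      by (simp add: ims power2_eq_square abs_mult[symmetric])
    ultimately have "1 + (cmod (geodesic_between p q s - geodesic_between p q t))\<^sup>2 /
        (2 * Im (geodesic_between p q s) * Im (geodesic_between p q t)) =
        1 + r\<^sup>2 * (2 * (cosh (s - t) - 1) / (cosh s * cosh t)) / (2 * r\<^sup>2 / (cosh s * cosh t))"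
      by (simp only:)
    also have "\<dots> = cosh (s - t)" 
    proof -
      have *: "1 + x * (2 * (y - 1) / k) / (2 * x / k) = y" if "x \<noteq> 0" "k \<noteq> 0" for x y k :: real
        using that by (simp add: field_simps)
      show ?thesis using r c by (intro *) auto
    qed
    finally show ?thesis .
  next
    fix a assume "p = Real_Point a" "q = Infinity"
    then show ?thesis using exp_case[of s t] by (simp add: cmod_power2)
  next
    fix b assume "p = Infinity" "q = Real_Point b"
    then show ?thesis using exp_case[of "- s" "- t"] cosh_minus[of "s - t"]
      by (simp add: cmod_power2)
  qed (use assms in simp)
qed

text \<open>
  \<open>cross_det v w\<close> is the determinant of the vectors \<open>v\<close>, \<open>w\<close> under the identification of the
  complex plane with \<open>\<real>\<^sup>2\<close>; it is negative iff \<open>w\<close> points to the right of \<open>v\<close>. It does not vanish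
  for distinct geodesics at an intersection point.
\<close>

definition cross_det :: "complex \<Rightarrow> complex \<Rightarrow> real" where
  "cross_det v w = Re v * Im w - Im v * Re w"

definition crossing_sign :: "oriented_geodesic \<Rightarrow> oriented_geodesic \<Rightarrow> int" where
  "crossing_sign g h =
     (if geodesic_set g \<inter> geodesic_set h = {} \<or> (\<exists>p q. g = Doubly_Oriented p q) then 0
      else let z = (THE z. z \<in> geodesic_set g \<inter> geodesic_set h);
               v = tangent_direction h z;
               w = tangent_direction g z
           in if cross_det v w < 0 then 1 else if cross_det v w > 0 then - 1 else 0)"

definition Q_theta :: "rat set" where
  "Q_theta = {of_int a / of_int c | a c :: int. coprime a c \<and> c \<ge> 1 \<and> odd (a + c)}"

text \<open>
  Listing the endpoints of the doubly oriented edges by size ensures that interchanging the two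
  rationals yields the same edge.
\<close>

definition net_edge :: "int \<Rightarrow> int \<Rightarrow> int \<Rightarrow> int \<Rightarrow> oriented_geodesic" where
  "net_edge a c b d =
     (let x = of_int a / of_int c; y = of_int b / of_int d in
      if c < d then Directed (Real_Point x) (Real_Point y)
      else if d < c then Directed (Real_Point y) (Real_Point x)
      else Doubly_Oriented (Real_Point (min x y)) (Real_Point (max x y)))"

definition net_theta :: "oriented_geodesic set" where
  "net_theta = {net_edge a c b d | a c b d.
     c \<ge> 1 \<and> d \<ge> 1 \<and> coprime a c \<and> coprime b d \<and>
     odd a \<and> odd b \<and> odd c \<and> odd d \<and> (a * d - b * c = 2 \<or> a * d - b * c = - 2)}"

definition vertical_geodesic :: "rat \<Rightarrow> oriented_geodesic" where
  "vertical_geodesic x = Directed Infinity (Real_Point (of_rat x))"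

text \<open>
  The sum over the whole net is taken over its nonzero terms, which are finite in number by
  \<open>finite_crossings\<close>.
\<close>

definition I_theta :: "rat \<Rightarrow> int" where
  "I_theta x = (\<Sum>g | g \<in> net_theta \<and> crossing_sign g (vertical_geodesic x) \<noteq> 0.
     crossing_sign g (vertical_geodesic x))"

lemma net_edge_bounds:
  fixes a b c d m n :: int
  assumes cd: "c \<ge> 1" "d \<ge> 1" "n \<ge> 1"
    and det: "a * d - b * c = 2 \<or> a * d - b * c = - 2"
    and between: "min (of_int a / of_int c) (of_int b / of_int d) < (of_int m / of_int n :: real)"
      "(of_int m / of_int n :: real) < max (of_int a / of_int c) (of_int b / of_int d)"
  shows "c + d \<le> 2 * n"
proof -
  have main: "c + d \<le> 2 * n"
    if "c \<ge> 1" "d \<ge> 1" "a * d - b * c = - 2"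
      "(of_int a / of_int c :: real) < of_int m / of_int n"
      "(of_int m / of_int n :: real) < of_int b / of_int d"
    for a b c d :: int
  proof -
    have "real_of_int (a * n) < of_int (m * c)" using that cd by (simp add: field_simps)
    then have 1: "m * c - a * n \<ge> 1" by linarith
    have "real_of_int (m * d) < of_int (b * n)" using that cd by (simp add: field_simps)
    then have 2: "b * n - m * d \<ge> 1" by linarith
    have "c + d \<le> c * (b * n - m * d) + d * (m * c - a * n)"
      using mult_left_mono[OF 2, of c] mult_left_mono[OF 1, of d] \<open>c \<ge> 1\<close> \<open>d \<ge> 1\<close> by linarith
    also have "\<dots> = - (a * d - b * c) * n" by (simp add: algebra_simps)
    finally show ?thesis using that by simp
  qed
  have less: "(of_int a / of_int c :: real) < of_int b / of_int d \<longleftrightarrow> a * d < b * c"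
  proof -
    have "(of_int a / of_int c :: real) < of_int b / of_int d \<longleftrightarrow>
        real_of_int (a * d) < of_int (b * c)" using cd by (simp add: field_simps)
    then show ?thesis by (simp only: of_int_less_iff)
  qed
  from det show ?thesis
  proof
    assume *: "a * d - b * c = - 2"
    with less have "(of_int a / of_int c :: real) < of_int b / of_int d" by linarith
    with between main[of c d a b] * cd show ?thesis by simp
  next
    assume *: "a * d - b * c = 2"
    with less have "\<not> (of_int a / of_int c :: real) < of_int b / of_int d" by linarith
    moreover have "b * c - a * d = - 2" using * by simp
    ultimately show ?thesis using between main[of d c b a] cd by (auto simp: min_def max_def split: if_splits)
  qed
qed

lemma finite_crossings: "finite {g \<in> net_theta. crossing_sign g (vertical_geodesic x) \<noteq> 0}"
proof -
  obtain m n :: int where mn: "x = of_int m / of_int n" "n \<ge> 1"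
    by (cases x) (force simp: Fract_of_int_quotient)
  define X :: real where "X = of_int m / of_int n"
  have xX: "of_rat x = X" by (simp add: mn X_def of_rat_divide)
  define B where "B = 2 * n * (\<bar>m\<bar> + 2)"
  define F where "F = (\<lambda>(a, c, b, d). net_edge a c b d) ` ({-B..B} \<times> {0..B} \<times> {-B..B} \<times> {0..B})"
  have "g \<in> F" if g: "g \<in> net_theta" and nz: "crossing_sign g (vertical_geodesic x) \<noteq> 0" for g
  proof -
    from g obtain a c b d where abcd: "g = net_edge a c b d" "c \<ge> 1" "d \<ge> 1"
      "a * d - b * c = 2 \<or> a * d - b * c = - 2"
      unfolding net_theta_def by auto
    define p q :: real where "p = of_int a / of_int c" and "q = of_int b / of_int d"
    from nz obtain z where z: "z \<in> geodesic_set g" "z \<in> geodesic_set (vertical_geodesic x)"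
      by (auto simp: crossing_sign_def split: if_splits)
    have Rez: "Re z = X" using z(2) by (simp add: vertical_geodesic_def geodesic_half_line xX)
    have "\<exists>u v. {u, v} = {p, q} \<and> geodesic_param g = geodesic_between (Real_Point u) (Real_Point v)"
    proof -
      have minmax: "{min p q, max p q} = {p, q}" by (auto simp: min_def max_def)
      consider "c < d" | "d < c" | "c = d" by linarith
      then show ?thesis
      proof cases
        case 1
        then have "g = Directed (Real_Point p) (Real_Point q)"
          by (simp add: abcd(1) net_edge_def p_def q_def)
        then show ?thesis by (intro exI[of _ p] exI[of _ q]) auto
      next
        case 2
        then have "g = Directed (Real_Point q) (Real_Point p)"
          by (simp add: abcd(1) net_edge_def p_def q_def)
        then show ?thesis by (intro exI[of _ q] exI[of _ p]) auto
      next
        case 3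
        then have "g = Doubly_Oriented (Real_Point (min p q)) (Real_Point (max p q))"
          by (simp add: abcd(1) net_edge_def Let_def p_def q_def)
        then show ?thesis using minmax by (intro exI[of _ "min p q"] exI[of _ "max p q"]) auto
      qed
    qed
    then obtain t u v where t: "Re z = (u + v) / 2 + (v - u) / 2 * tanh t"
      and uv: "{u, v} = {p, q}"
      using z(1) by (auto simp: geodesic_set_def)
    have diff: "\<bar>a * d - b * c\<bar> = 2" using abcd(4) by auto
    have "p \<noteq> q"
    proof
      assume "p = q"
      then have "real_of_int (a * d) = of_int (b * c)" using abcd(2,3) by (simp add: p_def q_def field_simps)
      then have "a * d = b * c" by (simp only: of_int_eq_iff)
      with diff show False by simp
    qed
    then have "\<bar>(v - u) / 2 * tanh t\<bar> < \<bar>(v - u) / 2\<bar>"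
      using abs_tanh_less_one[of t] uv by (auto simp: abs_mult doubleton_eq_iff)
    then have lt: "min p q < X" "X < max p q"
      using t uv Rez by (auto simp: doubleton_eq_iff min_def max_def abs_if field_simps split: if_splits)
    have cd: "c + d \<le> 2 * n"
      using net_edge_bounds[OF abcd(2,3) mn(2) abcd(4)] lt by (simp add: p_def q_def X_def)
    have pq: "\<bar>p - q\<bar> \<le> 2"
    proof -
      have "p - q = of_int (a * d - b * c) / of_int (c * d)"
        using abcd(2,3) by (simp add: p_def q_def field_simps)
      then have "\<bar>p - q\<bar> = 2 / of_int (c * d)" using diff abcd(2,3)
        by (simp only: abs_divide of_int_abs[symmetric]) (simp add: abs_mult)
      moreover have "c * d \<ge> 1" using mult_mono[of 1 c 1 d] abcd(2,3) by simp
      then have "real_of_int (c * d) \<ge> 1" by linarith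
      ultimately show ?thesis by (simp add: divide_le_eq del: of_int_mult)
    qed
    have absX: "\<bar>X\<bar> \<le> \<bar>m\<bar>"
    proof -
      have "\<bar>real_of_int m\<bar> * 1 \<le> \<bar>of_int m\<bar> * of_int n" using mn(2) by (intro mult_left_mono) auto
      then show ?thesis using mn(2) by (simp add: X_def abs_divide divide_le_eq)
    qed
    have P: "\<bar>p\<bar> \<le> of_int (\<bar>m\<bar> + 2)" "\<bar>q\<bar> \<le> of_int (\<bar>m\<bar> + 2)"
      using pq absX lt by (auto simp: min_def max_def split: if_splits)
    have bound: "\<bar>k\<bar> \<le> B"
      if "\<bar>of_int k / real_of_int l\<bar> \<le> of_int (\<bar>m\<bar> + 2)" "l \<ge> 1" "l \<le> 2 * n" for k l :: int
    proof -
      have "\<bar>real_of_int k\<bar> \<le> of_int (\<bar>m\<bar> + 2) * of_int l"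
        using that by (simp add: abs_divide pos_divide_le_eq)
      then have "real_of_int \<bar>k\<bar> \<le> of_int ((\<bar>m\<bar> + 2) * l)" by simp
      then have "\<bar>k\<bar> \<le> (\<bar>m\<bar> + 2) * l" by (simp only: of_int_le_iff)
      also have "\<dots> \<le> (\<bar>m\<bar> + 2) * (2 * n)" using that by (intro mult_left_mono) auto
      finally show ?thesis by (simp add: B_def mult.commute)
    qed
    have "2 * n * 1 \<le> B" unfolding B_def using mn(2) by (intro mult_left_mono) auto
    then have "c \<le> B" "d \<le> B" using cd abcd(2,3) by auto
    moreover have "\<bar>a\<bar> \<le> B" "\<bar>b\<bar> \<le> B"
      using bound[of a c] bound[of b d] P cd abcd(2,3) by (auto simp: p_def q_def)
    ultimately have "(a, c, b, d) \<in> {-B..B} \<times> {0..B} \<times> {-B..B} \<times> {0..B}"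
      using abcd(2,3) by auto
    then show ?thesis unfolding F_def abcd(1) by (intro image_eqI[of _ _ "(a, c, b, d)"]) auto
  qed
  then have "{g \<in> net_theta. crossing_sign g (vertical_geodesic x) \<noteq> 0} \<subseteq> F" by blast
  moreover have "finite F" unfolding F_def by (intro finite_imageI finite_cartesian_product) auto
  ultimately show ?thesis by (rule finite_subset)
qed

end

theory Submission
  imports Defs
begin

text \<open>
  The sign of the crossing of the vertical geodesic to \<open>x\<close> with an edge joining \<open>a / c\<close> and
  \<open>b / d\<close>, where \<open>a / c < x < b / d\<close>, is \<open>sgn (c - d)\<close>, so (1) and (2) are symmetries of the net. The
  inversion permutes the edges with positive endpoints and turns \<open>sgn (c - d)\<close> into \<open>sgn (b - a)\<close>.
  From \<open>b * c - a * d = 2\<close> and oddness, \<open>sgn (c - d) + sgn (b - a)\<close> vanishes unless \<open>c = d\<close> or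
  \<open>a = b\<close>, when it is \<open>1\<close>; above \<open>x > 1\<close> there is exactly one such edge, joining two consecutive
  odd integers, and this gives (3). Uniqueness is the Euclidean algorithm: by (1) and (2) one may
  assume \<open>0 \<le> x < 1\<close>, and then (3) passes to a smaller denominator.
\<close>

section \<open>Crossing signs\<close>

lemma has_vector_derivative_Complex:
  assumes "(f has_real_derivative f') (at t)" "(g has_real_derivative g') (at t)"
  shows "((\<lambda>t. Complex (f t) (g t)) has_vector_derivative Complex f' g') (at t)"
proof -
  have "((\<lambda>t. of_real (f t) + \<i> * of_real (g t)) has_vector_derivative
      of_real f' + \<i> * of_real g') (at t)"
    using assms
    by (intro derivative_intros has_vector_derivative_mult_right has_vector_derivative_of_real)
  then show ?thesis by (simp add: Complex_eq)
qed

text \<open>The imaginary part stays anonymous: against a vertical tangent only the real component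
  of the velocity enters \<open>cross_det\<close>.\<close>

lemma geodesic_half_circle_derivative:
  "\<exists>u. (geodesic_between (Real_Point p) (Real_Point q) has_vector_derivative
     Complex ((q - p) / 2 * (1 - tanh t ^ 2)) u) (at t)"
proof -
  have tanh: "(tanh has_real_derivative 1 - tanh t ^ 2) (at t)"
    using has_field_derivative_tanh[of "\<lambda>t. t" t 1 UNIV] cosh_real_nonzero[of t] by simp
  have re: "((\<lambda>t. (p + q) / 2 + (q - p) / 2 * tanh t) has_real_derivative
      (q - p) / 2 * (1 - tanh t ^ 2)) (at t)"
    using DERIV_add[OF DERIV_const[of "(p + q) / 2"] DERIV_cmult[OF tanh, of "(q - p) / 2"]]
    by (simp only: add_0)
  note im = DERIV_divide[OF DERIV_const[of "\<bar>q - p\<bar> / 2"]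
      has_field_derivative_cosh[OF DERIV_ident] cosh_real_nonzero]
  have "geodesic_between (Real_Point p) (Real_Point q) =
      (\<lambda>t. Complex ((p + q) / 2 + (q - p) / 2 * tanh t) (\<bar>q - p\<bar> / 2 / cosh t))"
    by (rule ext) simp
  then show ?thesis
    by (simp only:) (rule exI, rule has_vector_derivative_Complex[OF re im])
qed

lemma geodesic_half_line_derivative:
  "(geodesic_between Infinity (Real_Point x) has_vector_derivative Complex 0 (- exp (- t))) (at t)"
proof -
  have "((\<lambda>t. Complex x (exp (- t))) has_vector_derivative Complex 0 (- exp (- t))) (at t)"
    by (rule has_vector_derivative_Complex) (auto intro!: derivative_eq_intros)
  moreover have "geodesic_between Infinity (Real_Point x) = (\<lambda>t. Complex x (exp (- t)))"
    by (rule ext) simp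
  ultimately show ?thesis by simp
qed

lemma tangent_direction_eq:
  assumes "inj (geodesic_param g)" "(geodesic_param g has_vector_derivative w) (at t)"
  shows "tangent_direction g (geodesic_param g t) = w"
proof -
  have "(THE s. geodesic_param g s = geodesic_param g t) = t"
    using assms(1) by (auto dest: injD)
  then show ?thesis using assms(2) by (simp add: tangent_direction_def vector_derivative_at)
qed

lemma tanh_artanh_real:
  assumes "\<bar>u :: real\<bar> < 1"
  shows "tanh (artanh u) = u"
proof -
  have u: "1 - u > 0" "1 + u > 0" using assms by auto
  then have "exp (- 2 * artanh u) = (1 - u) / (1 + u)" by (simp add: artanh_def exp_minus)
  then have "tanh (artanh u) = (1 - (1 - u) / (1 + u)) / (1 + (1 - u) / (1 + u))"
    by (simp only: tanh_real_altdef)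
  also have "\<dots> = u" using u by (simp add: field_simps)
  finally show ?thesis .
qed

text \<open>The tangent of the vertical geodesic points down, so its determinant with the tangent of
  the half circle has the sign of \<open>q - p\<close>: only the left-to-right direction of the half
  circle matters.\<close>

lemma crossing_sign_vertical:
  assumes "p \<noteq> q"
  shows "crossing_sign (Directed (Real_Point p) (Real_Point q)) (Directed Infinity (Real_Point x)) =
    (if p < x \<and> x < q then - 1 else if q < x \<and> x < p then 1 else 0)"
proof -
  define g where "g = Directed (Real_Point p) (Real_Point q)"
  define h where "h = Directed Infinity (Real_Point x)"
  have g: "geodesic_param g t =
      Complex ((p + q) / 2 + (q - p) / 2 * tanh t) (\<bar>q - p\<bar> / 2 / cosh t)" for t
    by (simp add: g_def)
  have inj_g: "inj (geodesic_param g)" using assms by (auto simp: inj_def g)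
  have inj_h: "inj (geodesic_param h)" by (auto simp: inj_def h_def)
  have disj: "\<not> (p < x \<and> x < q)" "\<not> (q < x \<and> x < p)"
    if empty: "geodesic_set g \<inter> geodesic_set h = {}"
  proof -
    have False if *: "min p q < x" "x < max p q"
    proof -
      \<comment> \<open>The position of \<open>x\<close> on the scale on which \<open>p\<close> is
        \<open>-1\<close> and \<open>q\<close> is \<open>1\<close>; the half circle lies above
        \<open>x\<close> at parameter \<open>artanh u\<close>.\<close>
      define u where "u = (x - (p + q) / 2) / ((q - p) / 2)"
      have "\<bar>x - (p + q) / 2\<bar> < \<bar>(q - p) / 2\<bar>"
        using * by (auto simp: min_def max_def abs_if field_simps split: if_splits)
      then have "\<bar>u\<bar> < 1" unfolding u_def abs_divide using assms by (subst divide_less_eq_1_pos) auto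
      then have tanh: "tanh (artanh u) = u" by (rule tanh_artanh_real)
      have "(q - p) / 2 * u = x - (p + q) / 2"
        unfolding u_def using assms
        by (simp only: times_divide_eq_right) (rule nonzero_mult_div_cancel_left, simp)
      then have "Re (geodesic_param g (artanh u)) = x" by (simp only: g complex.sel tanh)
      moreover have "Im (geodesic_param g (artanh u)) > 0"
        using assms by (simp add: g cosh_real_pos)
      ultimately have "geodesic_param g (artanh u) \<in> geodesic_set g \<inter> geodesic_set h"
        by (simp add: geodesic_set_def[of g] h_def geodesic_half_line)
      with empty show False by blast
    qed
    then show "\<not> (p < x \<and> x < q)" "\<not> (q < x \<and> x < p)" by (auto simp: min_def max_def)
  qed
  show ?thesis
  proof (cases "geodesic_set g \<inter> geodesic_set h = {}")
    case True
    then show ?thesis using disj by (simp add: crossing_sign_def g_def h_def)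
  next
    case False
    then obtain z where z: "z \<in> geodesic_set g" "z \<in> geodesic_set h" by blast
    have uniq: "z' = z" if z': "z' \<in> geodesic_set g" "z' \<in> geodesic_set h" for z'
    proof -
      from z obtain t where t: "z = geodesic_param g t" by (auto simp: geodesic_set_def)
      from z' obtain s where s: "z' = geodesic_param g s" by (auto simp: geodesic_set_def)
      have "Re z = Re z'" using z(2) z'(2) by (simp add: h_def geodesic_half_line)
      then have "tanh t = tanh s" using assms by (simp add: t s g)
      then show ?thesis by (simp add: t s)
    qed
    have the: "(THE z. z \<in> geodesic_set g \<inter> geodesic_set h) = z"
      by (rule the_equality) (use z uniq in blast)+
    obtain t where t: "z = geodesic_param g t" using z by (auto simp: geodesic_set_def)
    obtain s where s: "z = geodesic_param h s" using z by (auto simp: geodesic_set_def)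
    obtain u where u: "tangent_direction g z = Complex ((q - p) / 2 * (1 - tanh t ^ 2)) u"
    proof -
      obtain u where "(geodesic_param g has_vector_derivative
          Complex ((q - p) / 2 * (1 - tanh t ^ 2)) u) (at t)"
        using geodesic_half_circle_derivative unfolding g_def geodesic_param.simps by blast
      from tangent_direction_eq[OF inj_g this, folded t] show ?thesis by (rule that)
    qed
    have "(geodesic_param h has_vector_derivative Complex 0 (- exp (- s))) (at s)"
      unfolding h_def geodesic_param.simps by (rule geodesic_half_line_derivative)
    from tangent_direction_eq[OF inj_h this]
    have v: "tangent_direction h z = Complex 0 (- exp (- s))" unfolding s .
    have det: "cross_det (tangent_direction h z) (tangent_direction g z) =
        (exp (- s) * (1 - tanh t ^ 2) / 2) * (q - p)"
      by (simp add: cross_det_def u v)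
    have t1: "\<bar>tanh t\<bar> < 1" by (rule abs_tanh_less_one)
    then have "tanh t ^ 2 < 1" by (simp add: abs_square_less_1)
    then have pos: "exp (- s) * (1 - tanh t ^ 2) / 2 > 0" by simp
    have "Re z = x" using z(2) by (simp add: h_def geodesic_half_line)
    then have x: "x = (p + q) / 2 + (q - p) / 2 * tanh t" by (simp add: t g)
    have "\<bar>(q - p) / 2 * tanh t\<bar> < \<bar>(q - p) / 2\<bar>"
      using t1 assms by (simp add: abs_mult)
    then have btw: "min p q < x \<and> x < max p q"
      unfolding x by (auto simp: min_def max_def abs_if field_simps split: if_splits)
    have "\<not> (\<exists>p q. g = Doubly_Oriented p q)" by (simp add: g_def)
    with False have "crossing_sign g h =
        (let k = (exp (- s) * (1 - tanh t ^ 2) / 2) * (q - p) in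
         if k < 0 then 1 else if k > 0 then - 1 else 0)"
      by (simp only: crossing_sign_def the Let_def det) simp
    then have "crossing_sign g h = (if q < p then 1 else - 1)"
      using pos assms by (simp only: Let_def mult_less_0_iff zero_less_mult_iff) auto
    then show ?thesis using btw assms by (auto simp: g_def h_def min_def max_def)
  qed
qed

section \<open>A combinatorial formula\<close>

text \<open>An edge is encoded by integers with its left endpoint first, which fixes the sign of the
  determinant and turns symmetries of the net into substitutions. Lowest terms follow by
  \<open>coprime_of_odd_det\<close>.\<close>

definition edges_over :: "rat \<Rightarrow> (int \<times> int \<times> int \<times> int) set" where
  "edges_over x = {(a, c, b, d). odd a \<and> odd b \<and> odd c \<and> odd d \<and> c \<ge> 1 \<and> d \<ge> 1 \<and>
     b * c - a * d = 2 \<and> of_int a / of_int c < x \<and> x < of_int b / of_int d}"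

fun edge_sign :: "int \<times> int \<times> int \<times> int \<Rightarrow> int" where
  "edge_sign (a, c, b, d) = sgn (c - d)"

text \<open>A common divisor of \<open>a\<close> and \<open>c\<close> divides 2, and it is odd
  because it divides \<open>a\<close>.\<close>

lemma coprime_of_odd_det:
  fixes a b c d :: int
  assumes "odd a" "b * c - a * d = 2 \<or> b * c - a * d = - 2"
  shows "coprime a c"
proof -
  have "is_unit k" if k: "k dvd a" "k dvd c" for k
  proof -
    have "k dvd b * c - a * d" using k by (intro dvd_diff dvd_mult dvd_mult2)
    then have "k dvd 2" using assms(2) by (metis dvd_minus_iff)
    have "odd k" using k(1) assms(1) dvd_trans by blast
    then have "coprime k 2" by simp
    with \<open>k dvd 2\<close> show ?thesis using coprime_common_divisor[of k 2 k] by simp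
  qed
  then show ?thesis by (intro coprimeI)
qed

lemma lowest_terms_unique:
  fixes a c a' c' :: int
  assumes "(of_int a / of_int c :: real) = of_int a' / of_int c'"
    and "coprime a c" "coprime a' c'" "c \<ge> 1" "c' \<ge> 1"
  shows "a = a' \<and> c = c'"
proof -
  have "real_of_int (a * c') = of_int (a' * c)" using assms by (simp add: field_simps)
  then have "a * c' = a' * c" by (simp only: of_int_eq_iff)
  then have "\<bar>a\<bar> * \<bar>c'\<bar> = \<bar>a'\<bar> * \<bar>c\<bar>" by (simp only: abs_mult[symmetric])
  with coprime_crossproduct_int[OF assms(2,3)] have "\<bar>c'\<bar> = \<bar>c\<bar>" by blast
  then have "c = c'" using assms by auto
  with \<open>a * c' = a' * c\<close> assms show ?thesis by auto
qed

lemma int_fraction_less: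
  fixes a b c d :: int
  assumes "c \<ge> 1" "d \<ge> 1"
  shows "(of_int a / of_int c :: 'a :: linordered_field) < of_int b / of_int d \<longleftrightarrow> a * d < b * c"
proof -
  have "(of_int a / of_int c :: 'a) < of_int b / of_int d \<longleftrightarrow> (of_int (a * d) :: 'a) < of_int (b * c)"
    using assms by (simp add: field_simps)
  then show ?thesis by (simp only: of_int_less_iff)
qed

lemma net_edge_swap: "net_edge a c b d = net_edge b d a c"
  by (simp add: net_edge_def Let_def min.commute max.commute)

lemma of_rat_fraction: "(of_rat (of_int a / of_int c) :: real) = of_int a / of_int c"
  by (simp add: of_rat_divide)

text \<open>A directed edge runs towards the larger denominator, so it goes from left to right
  exactly when \<open>c < d\<close>. For \<open>c = d\<close> it is doubly oriented, and both sides
  are 0.\<close>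

lemma crossing_sign_net_edge:
  assumes "c \<ge> 1" "d \<ge> 1" "b * c - a * d = 2"
  shows "crossing_sign (net_edge a c b d) (vertical_geodesic x) =
    (if of_int a / of_int c < x \<and> x < of_int b / of_int d then sgn (c - d) else 0)"
proof -
  define p q :: real where "p = of_int a / of_int c" and "q = of_int b / of_int d"
  have less: "p < q" unfolding p_def q_def using assms by (subst int_fraction_less) auto
  have "p < of_rat x \<longleftrightarrow> of_int a / of_int c < x" "of_rat x < q \<longleftrightarrow> x < of_int b / of_int d"
    unfolding p_def q_def of_rat_fraction[symmetric] of_rat_less by auto
  moreover consider "c < d" | "d < c" | "c = d" by linarith
  then have "crossing_sign (net_edge a c b d) (vertical_geodesic x) =
      (if p < of_rat x \<and> of_rat x < q then sgn (c - d) else 0)"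
  proof cases
    case 1
    then show ?thesis using less crossing_sign_vertical[of p q "of_rat x"]
      by (auto simp: net_edge_def vertical_geodesic_def p_def q_def)
  next
    case 2
    then show ?thesis using less crossing_sign_vertical[of q p "of_rat x"]
      by (auto simp: net_edge_def vertical_geodesic_def p_def q_def)
  next
    case 3
    then show ?thesis by (simp add: net_edge_def Let_def crossing_sign_def)
  qed
  ultimately show ?thesis by simp
qed

text \<open>A nonzero sign makes the edge directed, so its endpoints can be read off; their
  increasing order rules out an interchange, and lowest terms recover the integers.\<close>

lemma inj_on_net_edge:
  "inj_on (\<lambda>(a, c, b, d). net_edge a c b d) {e \<in> edges_over x. edge_sign e \<noteq> 0}"
proof -
  have "(a, c, b, d) = (a', c', b', d')"
    if e: "(a, c, b, d) \<in> edges_over x" "edge_sign (a, c, b, d) \<noteq> 0"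
      and e': "(a', c', b', d') \<in> edges_over x" "edge_sign (a', c', b', d') \<noteq> 0"
      and eq: "net_edge a c b d = net_edge a' c' b' d'" for a c b d a' c' b' d'
  proof -
    have cop: "coprime a c" "coprime b d" "coprime a' c'" "coprime b' d'"
      using e e' coprime_of_odd_det[of a b c d] coprime_of_odd_det[of b a d c]
        coprime_of_odd_det[of a' b' c' d'] coprime_of_odd_det[of b' a' d' c']
      by (auto simp: edges_over_def algebra_simps)
    have "(of_int a / of_int c :: real) < of_int b / of_int d"
      "(of_int a' / of_int c' :: real) < of_int b' / of_int d'"
      using e e' by (auto simp: edges_over_def int_fraction_less)
    then have "(of_int a / of_int c :: real) = of_int a' / of_int c'"
      "(of_int b / of_int d :: real) = of_int b' / of_int d'"
      using eq e(2) e'(2) by (auto simp: net_edge_def Let_def split: if_splits)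
    then show ?thesis
      using lowest_terms_unique cop e(1) e'(1) by (auto simp: edges_over_def)
  qed
  then show ?thesis by (auto intro!: inj_onI simp del: edge_sign.simps)
qed

lemma net_edge_image:
  "(\<lambda>(a, c, b, d). net_edge a c b d) ` {e \<in> edges_over x. edge_sign e \<noteq> 0} =
   {g. g \<in> net_theta \<and> crossing_sign g (vertical_geodesic x) \<noteq> 0}" (is "?f ` ?A = ?B")
proof (intro equalityI subsetI)
  fix g assume "g \<in> ?f ` ?A"
  then obtain a c b d where e: "(a, c, b, d) \<in> edges_over x" "sgn (c - d) \<noteq> 0"
    and g: "g = net_edge a c b d" by auto
  have cop: "coprime a c" "coprime b d"
    using e coprime_of_odd_det[of a b c d] coprime_of_odd_det[of b a d c]
    by (auto simp: edges_over_def algebra_simps)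
  have "crossing_sign g (vertical_geodesic x) \<noteq> 0"
    using e by (simp add: g crossing_sign_net_edge edges_over_def)
  moreover have "g \<in> net_theta"
    unfolding net_theta_def mem_Collect_eq
    using e cop by (intro exI[of _ a] exI[of _ c] exI[of _ b] exI[of _ d])
      (auto simp: g edges_over_def algebra_simps)
  ultimately show "g \<in> ?B" by simp
next
  fix g assume g: "g \<in> ?B"
  then obtain a c b d where "g = net_edge a c b d" "c \<ge> 1" "d \<ge> 1"
    "odd a" "odd b" "odd c" "odd d" "a * d - b * c = 2 \<or> a * d - b * c = - 2"
    unfolding net_theta_def by auto
  \<comment> \<open>If the determinant has the other sign, the two endpoints are
    interchanged.\<close>
  then obtain a c b d where e: "g = net_edge a c b d" "c \<ge> 1" "d \<ge> 1"
    "odd a" "odd b" "odd c" "odd d" "b * c - a * d = 2"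
    using net_edge_swap by (metis minus_diff_eq minus_minus)
  have "crossing_sign (net_edge a c b d) (vertical_geodesic x) \<noteq> 0" using g e(1) by simp
  then have "(a, c, b, d) \<in> ?A"
    using e by (auto simp: crossing_sign_net_edge edges_over_def split: if_splits)
  then show "g \<in> ?f ` ?A" using e(1) by force
qed

lemma edge_of_equal_denominators:
  fixes a b c :: int
  assumes "odd c" "c \<ge> 1" "b * c - a * c = 2"
  shows "c = 1" "b = a + 2"
proof -
  have eq: "(b - a) * c = 2" using assms(3) by (simp add: algebra_simps)
  then have "c dvd 2" by (metis dvd_triv_right)
  then have "c \<le> 2" by (rule zdvd_imp_le) simp
  then show "c = 1" using assms(1,2) by presburger
  then show "b = a + 2" using eq by simp
qed

text \<open>Edges of nonzero sign inject into the finite set of crossings. The others join odd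
  integers \<open>a\<close> and \<open>a + 2\<close> with \<open>x\<close> between them, which
  confines \<open>a\<close> to a bounded window.\<close>

lemma finite_edges_over: "finite (edges_over x)"
proof -
  let ?A = "{e \<in> edges_over x. edge_sign e \<noteq> 0}"
  let ?B = "(\<lambda>a. (a, 1, a + 2, 1)) ` {\<lfloor>x\<rfloor> - 2..\<lceil>x\<rceil>}"
  have "finite ?A"
    using finite_imageD[OF _ inj_on_net_edge] finite_crossings[of x]
    unfolding net_edge_image by blast
  moreover have "(a, c, b, d) \<in> ?B"
    if e: "(a, c, b, d) \<in> edges_over x" "edge_sign (a, c, b, d) = 0" for a c b d
  proof -
    have "c = d" using e(2) by (simp add: sgn_0_0)
    with e(1) edge_of_equal_denominators[of c b a] have *: "c = 1" "d = 1" "b = a + 2"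
      by (auto simp: edges_over_def)
    with e(1) have "of_int a < x" "x < of_int a + 2" by (auto simp: edges_over_def)
    then have "a \<in> {\<lfloor>x\<rfloor> - 2..\<lceil>x\<rceil>}" unfolding atLeastAtMost_iff by linarith
    with * show ?thesis by simp
  qed
  then have "edges_over x \<subseteq> ?A \<union> ?B" by (auto simp del: edge_sign.simps)
  ultimately show ?thesis by (simp add: finite_subset)
qed

text \<open>Edges of sign 0 are readmitted to the sum because the inversion does not preserve the
  condition \<open>c \<noteq> d\<close>.\<close>

lemma I_theta_eq: "I_theta x = (\<Sum>e\<in>edges_over x. edge_sign e)"
proof -
  let ?f = "\<lambda>(a, c, b, d). net_edge a c b d"
  let ?A = "{e \<in> edges_over x. edge_sign e \<noteq> 0}"
  have "I_theta x = (\<Sum>g\<in>?f ` ?A. crossing_sign g (vertical_geodesic x))"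
    by (simp only: I_theta_def net_edge_image)
  also have "\<dots> = (\<Sum>e\<in>?A. crossing_sign (?f e) (vertical_geodesic x))"
    by (rule sum.reindex[OF inj_on_net_edge, unfolded comp_def])
  also have "\<dots> = (\<Sum>e\<in>?A. edge_sign e)"
    by (rule sum.cong) (auto simp: crossing_sign_net_edge edges_over_def)
  also have "\<dots> = (\<Sum>e\<in>edges_over x. edge_sign e)"
    by (rule sum.mono_neutral_left) (auto simp: finite_edges_over)
  finally show ?thesis .
qed

section \<open>The functional equations\<close>

text \<open>Reflection interchanges the left and right endpoints, and with them \<open>c\<close> and
  \<open>d\<close>.\<close>

lemma I_theta_uminus: "I_theta (- x) = - I_theta x"
proof -
  have "(\<Sum>e\<in>edges_over (- x). edge_sign e) = (\<Sum>e\<in>edges_over x. - edge_sign e)"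
    by (rule sum.reindex_bij_witness[where
          i = "\<lambda>(a, c, b, d). (- b, d, - a, c)" and j = "\<lambda>(a, c, b, d). (- b, d, - a, c)"])
       (auto simp: edges_over_def sgn_if algebra_simps)
  then show ?thesis by (simp add: I_theta_eq sum_negf)
qed

text \<open>Translation by 2 keeps the denominators, the determinant and the parity of the
  numerators.\<close>

lemma I_theta_add_2: "I_theta (x + 2) = I_theta x"
proof -
  have "(\<Sum>e\<in>edges_over (x + 2). edge_sign e) = (\<Sum>e\<in>edges_over x. edge_sign e)"
    by (rule sum.reindex_bij_witness[where
          i = "\<lambda>(a, c, b, d). (a + 2 * c, c, b + 2 * d, d)" and
          j = "\<lambda>(a, c, b, d). (a - 2 * c, c, b - 2 * d, d)"])
       (auto simp: edges_over_def field_simps)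
  then show ?thesis by (simp add: I_theta_eq)
qed

text \<open>A positive left endpoint makes both endpoints positive; on such edges the inversion
  simply reverses the order of the endpoints.\<close>

definition positive_edges_over :: "rat \<Rightarrow> (int \<times> int \<times> int \<times> int) set" where
  "positive_edges_over x = {(a, c, b, d) \<in> edges_over x. a > 0}"

text \<open>With denominators cleared, the conditions become symmetric under exchanging numerators
  with denominators.\<close>

lemma positive_edges_over_iff:
  assumes "x > 0"
  shows "(a, c, b, d) \<in> positive_edges_over x \<longleftrightarrow>
    odd a \<and> odd b \<and> odd c \<and> odd d \<and> a \<ge> 1 \<and> b \<ge> 1 \<and> c \<ge> 1 \<and> d \<ge> 1 \<and>
     b * c - a * d = 2 \<and> of_int a < x * of_int c \<and> x * of_int d < of_int b"
proof -
  have "b \<ge> 1" if "x * of_int d < of_int b" "d \<ge> 1"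
  proof -
    have "0 < x * of_int d" using assms that by simp
    then have "(0 :: rat) < of_int b" using that by linarith
    then show ?thesis by simp
  qed
  then show ?thesis by (auto simp: positive_edges_over_def edges_over_def field_simps)
qed

text \<open>The only edge crossing the imaginary axis joins \<open>-1\<close> to \<open>1\<close>, and it is doubly oriented.\<close>

lemma I_theta_eq_positive:
  assumes "x > 0"
  shows "I_theta x = (\<Sum>e\<in>positive_edges_over x. edge_sign e)"
proof -
  have "edge_sign e = 0" if e: "e \<in> edges_over x - positive_edges_over x" for e
  proof -
    obtain a c b d where [simp]: "e = (a, c, b, d)" by (cases e)
    have *: "odd a" "a \<le> 0" "c \<ge> 1" "d \<ge> 1" "b * c - a * d = 2" "0 < (of_int b / of_int d :: rat)"
      using e assms by (auto simp: positive_edges_over_def edges_over_def)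
    have "b \<ge> 1" using * by (simp add: zero_less_divide_iff)
    have "a \<noteq> 0" using *(1) by auto
    then have "a \<le> - 1" using * by auto
    \<comment> \<open>The determinant 2 is the sum of \<open>b * c\<close> and
      \<open>- a * d\<close>, which are at least \<open>c\<close> and \<open>d\<close>; hence both
      denominators are 1.\<close>
    have "1 * c \<le> b * c" "1 * d \<le> - a * d"
      using * \<open>b \<ge> 1\<close> \<open>a \<le> - 1\<close> by (intro mult_right_mono; simp)+
    then have "c = d" using *(3-5) by linarith
    then show ?thesis by simp
  qed
  then show ?thesis unfolding I_theta_eq
    by (intro sum.mono_neutral_right) (auto simp: finite_edges_over positive_edges_over_def)
qed

text \<open>Inversion sends \<open>a / c < x < b / d\<close> to \<open>d / b < 1 / x < c / a\<close>
  with the same determinant, so the new denominators are \<open>b\<close> and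
  \<open>a\<close>.\<close>

lemma I_theta_inverse_eq_positive:
  assumes "x > 0"
  shows "I_theta (1 / x) = (\<Sum>(a, c, b, d)\<in>positive_edges_over x. sgn (b - a))"
proof -
  have inv: "1 / x > 0" using assms by simp
  have "(\<Sum>e\<in>positive_edges_over (1 / x). edge_sign e) =
      (\<Sum>(a, c, b, d)\<in>positive_edges_over x. sgn (b - a))"
    by (rule sum.reindex_bij_witness[where
          i = "\<lambda>(a, c, b, d). (d, b, c, a)" and j = "\<lambda>(a, c, b, d). (d, b, c, a)"])
       (use assms in \<open>auto simp: positive_edges_over_iff[OF assms] positive_edges_over_iff[OF inv]
          field_simps\<close>)
  then show ?thesis by (simp add: I_theta_eq_positive[OF inv])
qed

text \<open>If \<open>d < c\<close> and \<open>a < b\<close>, both gaps are at least 2 by parity and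
  the determinant exceeds 2; if \<open>c \<le> d\<close> and \<open>b \<le> a\<close>, it is not
  positive. Otherwise the two signs cancel, or exactly one of them is 0 and the other is 1.\<close>

lemma sgn_add_sgn_of_det:
  fixes a b c d :: int
  assumes "odd a" "odd b" "odd c" "odd d" "a \<ge> 1" "b \<ge> 1" "c \<ge> 1" "d \<ge> 1" "b * c - a * d = 2"
  shows "sgn (c - d) + sgn (b - a) = of_bool (c = d \<or> a = b)"
proof -
  have "\<not> (d < c \<and> a < b)"
  proof
    assume *: "d < c \<and> a < b"
    have "d + 2 \<le> c" "a + 2 \<le> b" using * assms by presburger+
    then have "(a + 2) * (d + 2) \<le> b * c" using assms by (intro mult_mono) auto
    then show False using assms by (simp add: algebra_simps)
  qed
  moreover have "\<not> (c \<le> d \<and> b \<le> a)"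
    using mult_mono[of b a c d] assms by auto
  moreover have "c \<noteq> d \<or> a \<noteq> b" using assms by auto
  ultimately show ?thesis
    by (cases c d rule: linorder_cases; cases a b rule: linorder_cases) auto
qed

lemma I_theta_inversion_gt_1:
  assumes "x > 1" and odd: "\<And>k. odd k \<Longrightarrow> x \<noteq> of_int k"
  shows "I_theta x + I_theta (1 / x) = 1"
proof -
  have x: "x > 0" using assms by simp
  \<comment> \<open>\<open>a = 2 * k + 1\<close> is the largest odd integer not above
    \<open>x\<close>; since \<open>x\<close> is not an odd integer, it lies strictly between
    \<open>a\<close> and \<open>a + 2\<close>.\<close>
  define k where "k = \<lfloor>(x - 1) / 2\<rfloor>"
  define a where "a = 2 * k + 1"
  have "of_int k \<le> (x - 1) / 2" "(x - 1) / 2 < of_int k + 1" unfolding k_def by linarith+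
  then have a_le: "of_int a \<le> x" "x < of_int a + 2" by (auto simp: a_def)
  have k: "k \<ge> 0" unfolding k_def using assms by simp
  have "odd a" by (simp add: a_def)
  with a_le odd have a: "of_int a < x" "x < of_int a + 2" by force+
  have mem: "(a, 1, a + 2, 1) \<in> positive_edges_over x"
    using a k \<open>odd a\<close> by (simp add: positive_edges_over_iff[OF x] a_def)
  have "I_theta x + I_theta (1 / x) =
      (\<Sum>(a, c, b, d)\<in>positive_edges_over x. sgn (c - d) + sgn (b - a))"
    unfolding I_theta_eq_positive[OF x] I_theta_inverse_eq_positive[OF x] sum.distrib[symmetric]
    by (rule sum.cong) auto
  also have "\<dots> = (\<Sum>(a, c, b, d)\<in>{(a, 1, a + 2, 1)}. sgn (c - d) + sgn (b - a))"
  proof (rule sum.mono_neutral_right)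
    show "finite (positive_edges_over x)"
      by (rule finite_subset[OF _ finite_edges_over[of x]]) (auto simp: positive_edges_over_def)
    show "{(a, 1, a + 2, 1)} \<subseteq> positive_edges_over x" using mem by simp
    have "sgn (c' - d') + sgn (b' - a') = 0"
      if e: "(a', c', b', d') \<in> positive_edges_over x" "(a', c', b', d') \<noteq> (a, 1, a + 2, 1)"
      for a' c' b' d'
    proof -
      have *: "odd a'" "odd b'" "odd c'" "odd d'" "a' \<ge> 1" "b' \<ge> 1" "c' \<ge> 1" "d' \<ge> 1"
        "b' * c' - a' * d' = 2" "of_int a' < x * of_int c'" "x * of_int d' < of_int b'"
        using e(1) by (auto simp: positive_edges_over_iff[OF x])
      \<comment> \<open>Equal denominators give an edge from \<open>a'\<close> to
        \<open>a' + 2\<close> over \<open>x\<close>, and parity then forces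
        \<open>a' = a\<close>.\<close>
      have "c' \<noteq> d'"
      proof
        assume cd: "c' = d'"
        then have c: "c' = 1" and b: "b' = a' + 2"
          using edge_of_equal_denominators[of c' b' a'] * by simp_all
        have "(of_int a' :: rat) < of_int (a + 2)" "(of_int a :: rat) < of_int (a' + 2)"
          using a * c b cd by (auto intro: less_trans)
        then have "a' < a + 2" "a < a' + 2" by (simp_all only: of_int_less_iff)
        then have "a' = a" using * \<open>odd a\<close> by presburger
        with b c cd e(2) show False by simp
      qed
      \<comment> \<open>Equal numerators divide 2 and are odd, hence are 1; the right endpoint
        \<open>1 / d'\<close> is then at most 1, against \<open>x > 1\<close>.\<close>
      moreover have "a' \<noteq> b'"
      proof
        assume ab: "a' = b'"
        then have eq: "a' * (c' - d') = 2" using * by (simp add: algebra_simps)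
        then have "a' dvd 2" by (metis dvd_triv_left)
        then have "a' \<le> 2" by (rule zdvd_imp_le) simp
        then have "b' = 1" using * ab by presburger
        then have "x * of_int d' < 1" using * by simp
        moreover have "1 * 1 \<le> x * of_int d'" using * assms by (intro mult_mono) auto
        ultimately show False by simp
      qed
      ultimately show ?thesis using sgn_add_sgn_of_det[OF *(1-9)] by simp
    qed
    then show "\<forall>e\<in>positive_edges_over x - {(a, 1, a + 2, 1)}.
        (case e of (a, c, b, d) \<Rightarrow> sgn (c - d) + sgn (b - a)) = 0" by auto
  qed
  also have "\<dots> = 1" by simp
  finally show ?thesis .
qed

section \<open>Closure properties of \<open>Q_theta\<close>, and the inversion law on it\<close>

lemma Q_thetaI: "coprime a c \<Longrightarrow> c \<ge> 1 \<Longrightarrow> odd (a + c) \<Longrightarrow> of_int a / of_int c \<in> Q_theta"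
  by (auto simp: Q_theta_def)

lemma Q_thetaE:
  assumes "x \<in> Q_theta"
  obtains a c where "x = of_int a / of_int c" "coprime a c" "c \<ge> 1" "odd (a + c)"
  using assms by (auto simp: Q_theta_def)

lemma Q_theta_uminus: "x \<in> Q_theta \<Longrightarrow> - x \<in> Q_theta"
  by (erule Q_thetaE) (use Q_thetaI[of "- _"] in force)

lemma Q_theta_inverse_pos:
  assumes "x \<in> Q_theta" "x > 0"
  shows "1 / x \<in> Q_theta"
  using assms(1)
proof (rule Q_thetaE)
  fix a c assume *: "x = of_int a / of_int c" "coprime a c" "c \<ge> 1" "odd (a + c)"
  then have "a \<ge> 1" using assms(2) by (simp add: zero_less_divide_iff)
  with * show ?thesis using Q_thetaI[of c a] by (simp add: coprime_commute add.commute)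
qed

text \<open>In lowest terms an odd integer has denominator 1, so numerator plus denominator is even.
  This discharges the hypothesis of \<open>I_theta_inversion_gt_1\<close>.\<close>

lemma Q_theta_not_odd:
  assumes "x \<in> Q_theta" "odd k"
  shows "x \<noteq> of_int k"
  using assms(1)
proof (rule Q_thetaE, intro notI)
  fix a c assume *: "x = of_int a / of_int c" "coprime a c" "c \<ge> 1" "odd (a + c)" "x = of_int k"
  then have "(of_int a :: rat) = of_int (k * c)" by (simp add: field_simps)
  then have "a = k * c" by (simp only: of_int_eq_iff)
  with * assms(2) have "is_unit c" by auto
  with * have "c = 1" by simp
  with * assms(2) \<open>a = k * c\<close> show False by simp
qed

text \<open>The equation is symmetric in \<open>x\<close> and \<open>1 / x\<close>, and
  \<open>x = 1\<close> is excluded by parity, so one may take \<open>x > 1\<close>.\<close>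

lemma I_theta_inversion_pos:
  assumes "x \<in> Q_theta" "x > 0"
  shows "I_theta x + I_theta (1 / x) = 1"
proof (cases "x > 1")
  case True
  then show ?thesis using I_theta_inversion_gt_1 Q_theta_not_odd assms(1) by blast
next
  case False
  moreover have "x \<noteq> 1" using Q_theta_not_odd[OF assms(1), of 1] by simp
  ultimately have "1 / x > 1" using assms by simp
  then have "I_theta (1 / x) + I_theta (1 / (1 / x)) = 1"
    using I_theta_inversion_gt_1 Q_theta_not_odd Q_theta_inverse_pos[OF assms] by blast
  then show ?thesis by simp
qed

lemma I_theta_inversion:
  assumes "x \<in> Q_theta" "x \<noteq> 0"
  shows "of_int (I_theta x + I_theta (1 / x)) = sgn x"
proof (cases "x > 0")
  case True
  then show ?thesis using I_theta_inversion_pos assms by simp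
next
  case False
  then have "I_theta (- x) + I_theta (1 / (- x)) = 1"
    using I_theta_inversion_pos[of "- x"] Q_theta_uminus assms by simp
  then have "I_theta x + I_theta (1 / x) = - 1"
    using I_theta_uminus[of x] I_theta_uminus[of "1 / x"] by simp
  then show ?thesis using False assms by simp
qed

section \<open>Uniqueness\<close>

lemma Q_theta_add_even:
  assumes "x \<in> Q_theta"
  shows "x + 2 * of_int k \<in> Q_theta"
  using assms
proof (rule Q_thetaE)
  fix a c assume *: "x = of_int a / of_int c" "coprime a c" "c \<ge> 1" "odd (a + c)"
  have "coprime (a + 2 * k * c) c"
    using *(2) by (metis coprime_iff_gcd_eq_1 gcd_add_mult mult.commute add.commute gcd.commute)
  then have "of_int (a + 2 * k * c) / of_int c \<in> Q_theta" using * by (intro Q_thetaI) auto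
  then show ?thesis using * by (simp add: add_divide_distrib)
qed

lemma periodic_on_Q_theta:
  fixes h :: "rat \<Rightarrow> 'a"
  assumes "\<And>x. x \<in> Q_theta \<Longrightarrow> h (x + 2) = h x" "x \<in> Q_theta"
  shows "h (x + 2 * of_int k) = h x"
proof (induction k rule: int_induct[of _ 0])
  case (step1 i)
  then show ?case
    using assms(1)[OF Q_theta_add_even[OF assms(2), of i]] by (simp add: algebra_simps)
next
  case (step2 i)
  then show ?case
    using assms(1)[OF Q_theta_add_even[OF assms(2), of "i - 1"]] by (simp add: algebra_simps)
qed simp

text \<open>To be applied to the difference of two solutions, in which the term \<open>sgn x\<close>
  cancels.\<close>

lemma odd_periodic_antisymmetric_eq_0:
  fixes h :: "rat \<Rightarrow> int"
  assumes uminus: "\<And>x. x \<in> Q_theta \<Longrightarrow> h (- x) = - h x"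
    and periodic: "\<And>x. x \<in> Q_theta \<Longrightarrow> h (x + 2) = h x"
    and inverse: "\<And>x. x \<in> Q_theta \<Longrightarrow> x \<noteq> 0 \<Longrightarrow> h x + h (1 / x) = 0"
    and "x \<in> Q_theta"
  shows "h x = 0"
proof -
  have "h (of_int a / of_int c) = 0" if "coprime a c" "c \<ge> 1" "odd (a + c)" for a c
    using that
  proof (induction "nat c" arbitrary: a c rule: less_induct)
    case less
    \<comment> \<open>Inversion replaces the denominator \<open>c\<close> by \<open>r < c\<close>,
      where the induction hypothesis applies.\<close>
    have small: "h (of_int r / of_int c) = 0" if r: "coprime r c" "0 < r" "r < c" "odd (r + c)" for r
    proof -
      have "h (of_int c / of_int r) = 0"
        using r by (intro less.hyps) (auto simp: coprime_commute add.commute)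
      moreover have "of_int r / of_int c \<in> Q_theta" using r by (intro Q_thetaI) auto
      ultimately show ?thesis using inverse[of "of_int r / of_int c"] r by simp
    qed
    \<comment> \<open>Adding \<open>c\<close> before dividing makes the remainder centred:
      \<open>r\<close> is the representative of \<open>a\<close> modulo \<open>2 * c\<close> in the
      interval from \<open>- c\<close> to \<open>c\<close>.\<close>
    define k where "k = (a + c) div (2 * c)"
    define r where "r = a - 2 * k * c"
    have rc: "r + c = (a + c) mod (2 * c)"
      by (simp add: r_def k_def minus_div_mult_eq_mod[symmetric] algebra_simps)
    then have "0 \<le> r + c" "r + c < 2 * c" using less.prems(2) by simp_all
    moreover have odd: "odd (r + c)" using less.prems(3) by (simp add: r_def)
    \<comment> \<open>Parity excludes the boundary value \<open>r = - c\<close>, so that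
      \<bar>r\<bar> < c holds strictly.\<close>
    then have "r + c \<noteq> 0" by (metis even_zero)
    ultimately have bounds: "- c < r" "r < c" by auto
    have cop: "coprime r c"
      using less.prems(1) gcd_add_mult[of c "- 2 * k" a]
      by (simp add: r_def coprime_iff_gcd_eq_1 gcd.commute algebra_simps)
    have Q: "of_int r / of_int c \<in> Q_theta" using cop odd less.prems(2) by (intro Q_thetaI)
    have "of_int a / of_int c = of_int r / of_int c + 2 * (of_int k :: rat)"
      using less.prems(2) by (simp add: r_def field_simps)
    then have eq: "h (of_int a / of_int c) = h (of_int r / of_int c)"
      using periodic_on_Q_theta[of h, OF periodic Q] by simp
    consider "r = 0" | "r > 0" | "r < 0" by linarith
    then show ?case
    proof cases
      case 1
      \<comment> \<open>At 0, oddness reads \<open>h 0 = - h 0\<close>, which forces the integer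
        \<open>h 0\<close> to vanish.\<close>
      then show ?thesis using eq uminus[OF Q] by simp
    next
      case 2
      then show ?thesis using eq small[of r] cop odd bounds by simp
    next
      case 3
      then have "h (of_int (- r) / of_int c) = 0" using cop odd bounds by (intro small) auto
      then show ?thesis using eq uminus[OF Q] by simp
    qed
  qed
  then show ?thesis using \<open>x \<in> Q_theta\<close> by (auto elim: Q_thetaE)
qed

theorem theorem5:
  shows "((\<forall>x\<in>Q_theta. I_theta (- x) = - I_theta x) \<and>
          (\<forall>x\<in>Q_theta. I_theta (x + 2) = I_theta x) \<and>
          (\<forall>x\<in>Q_theta. x \<noteq> 0 \<longrightarrow> of_int (I_theta x + I_theta (1 / x)) = sgn x)) \<and>
         (\<forall>f :: rat \<Rightarrow> int.
            (\<forall>x\<in>Q_theta. f (- x) = - f x) \<and>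
            (\<forall>x\<in>Q_theta. f (x + 2) = f x) \<and>
            (\<forall>x\<in>Q_theta. x \<noteq> 0 \<longrightarrow> of_int (f x + f (1 / x)) = sgn x)
            \<longrightarrow> (\<forall>x\<in>Q_theta. f x = I_theta x))"
proof -
  have unique: "f x = I_theta x"
    if f: "\<forall>x\<in>Q_theta. f (- x) = - f x" "\<forall>x\<in>Q_theta. f (x + 2) = f x"
      and inv: "\<forall>x\<in>Q_theta. x \<noteq> 0 \<longrightarrow> of_int (f x + f (1 / x)) = sgn x" and x: "x \<in> Q_theta"
    for f :: "rat \<Rightarrow> int" and x
  proof -
    define h where "h y = f y - I_theta y" for y
    have "h x = 0"
    proof (rule odd_periodic_antisymmetric_eq_0)
      fix y assume y: "y \<in> Q_theta"
      show "h (- y) = - h y" using f(1) y by (simp add: h_def I_theta_uminus)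
      show "h (y + 2) = h y" using f(2) y by (simp add: h_def I_theta_add_2)
      assume "y \<noteq> 0"
      then have "(of_int (f y + f (1 / y)) :: rat) = of_int (I_theta y + I_theta (1 / y))"
        using inv[rule_format, OF y] I_theta_inversion[OF y] by (simp only: simp_thms)
      then have "f y + f (1 / y) = I_theta y + I_theta (1 / y)" by (simp only: of_int_eq_iff)
      then show "h y + h (1 / y) = 0" by (simp add: h_def)
    qed (rule x)
    then show ?thesis by (simp add: h_def)
  qed
  show ?thesis
    by (intro conjI ballI allI impI; (elim conjE)?)
       ((rule I_theta_uminus I_theta_add_2 I_theta_inversion unique; assumption?)+)
qed

end
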